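(* Let $R$ be a commutative ring with unity and $I$ a proper ideal of $R$. The following conditions are equivalent: (i) $R$ is a Noetherian ring; (ii) $R(I)_{a,b}$ is a Noetherian ring for all $a,b\in R$; (iii) $R(I)_{a,b}$ is a Noetherian ring for some $a,b\in R$.
   Context: The Rees algebra of $R$ with respect to $I$ is $\mathcal R_+=\bigoplus_{n\ge 0} I^nt^n\subseteq R[t]$. For $a,b\in R$, let $(I^2(t^2+at+b))$ denote the ideal $(t^2+at+b)R[t]\cap \mathcal R_+$ of $\mathcal R_+$, and set $R(I)_{a,b}=\mathcal R_+/(I^2(t^2+at+b))$. Each element of $R(I)_{a,b}$ is uniquely represented by a polynomial $r+it$ with $r\in R$, $i\in I$. *)

theory Defs
  imports
    "HOL-Algebra.UnivPoly"
    "HOL-Algebra.Ideal_Product"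
    "HOL-Algebra.Ring_Divisibility"
begin

text \<open>
  Polynomial rings are taken from \<^theory>\<open>HOL-Algebra.UnivPoly\<close>: \<^term>\<open>UP R\<close> is R[t]. The power
  of an ideal is its power in the multiplicative monoid \<^term>\<open>ideals_set R\<close> of ideals of R,
  so its zeroth power is \<^term>\<open>carrier R\<close>.
\<close>

definition rees_algebra :: "('a, 'm) ring_scheme \<Rightarrow> 'a set \<Rightarrow> ('a, nat \<Rightarrow> 'a) up_ring"
  where "rees_algebra R I =
    (UP R) \<lparr> carrier :=
      {p \<in> carrier (UP R). \<forall>n::nat. coeff (UP R) p n \<in> I [^]\<^bsub>ideals_set R\<^esub> n} \<rparr>"

definition quad_poly :: "('a, 'm) ring_scheme \<Rightarrow> 'a \<Rightarrow> 'a \<Rightarrow> (nat \<Rightarrow> 'a)"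
  where "quad_poly R a b =
    up_ring.monom (UP R) \<one>\<^bsub>R\<^esub> 2 \<oplus>\<^bsub>UP R\<^esub> up_ring.monom (UP R) a 1 \<oplus>\<^bsub>UP R\<^esub> up_ring.monom (UP R) b 0"

text \<open>
  The ideal written (I^2(t^2+at+b)): the principal ideal is formed in R[t] and then contracted to
  the Rees algebra; it is not the ideal generated inside the Rees algebra.
\<close>

definition rees_quad_ideal :: "('a, 'm) ring_scheme \<Rightarrow> 'a set \<Rightarrow> 'a \<Rightarrow> 'a \<Rightarrow> (nat \<Rightarrow> 'a) set"
  where "rees_quad_ideal R I a b =
    (PIdl\<^bsub>UP R\<^esub> (quad_poly R a b)) \<inter> carrier (rees_algebra R I)"

definition rees_quotient ::
    "('a, 'm) ring_scheme \<Rightarrow> 'a set \<Rightarrow> 'a \<Rightarrow> 'a \<Rightarrow> (nat \<Rightarrow> 'a) set ring"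
  where "rees_quotient R I a b = rees_algebra R I Quot rees_quad_ideal R I a b"

end

theory Submission
  imports Defs "HOL-Algebra.Subrings"
begin

text \<open>
  Write \<open>Q\<close> for the quotient of the Rees algebra by the contraction of \<open>(t^2 + at + b)\<close>, and call the
  residue class of a constant polynomial \<open>r\<close> again \<open>r\<close>; this makes \<open>Q\<close> an extension of \<open>R\<close>.
  For every single choice of \<open>a\<close> and \<open>b\<close>, the ring \<open>R\<close> is Noetherian if and only if \<open>Q\<close> is. Both
  equivalences follow at once, because there is some choice of \<open>a\<close> and \<open>b\<close>.

  If \<open>R\<close> is Noetherian: the polynomial \<open>t^2 + at + b\<close> is monic, so division by it reduces every
  element of the Rees algebra to the form \<open>r + it\<close> with \<open>r \<in> R\<close>; and \<open>i \<in> I\<close>, because all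
  coefficients in positive degree lie in \<open>I\<close> and the division does not leave \<open>I\<close>
  (\<open>linear_remainder_mod_quad_poly\<close>). Hence \<open>Q\<close> is, as an \<open>R\<close>-module, a quotient of \<open>R \<oplus> I\<close>, and
  an ideal \<open>K\<close> of \<open>Q\<close> is controlled by two ideals of \<open>R\<close>: the constants in \<open>K\<close> and the
  coefficients of \<open>t\<close> in elements of \<open>K\<close>. A chain of ideals of \<open>Q\<close> must stop when both of these
  have stopped (\<open>noetherian_ring_if_sum_of_ring_and_ideal\<close>).

  If \<open>Q\<close> is Noetherian: every ideal \<open>J\<close> of \<open>R\<close> is the contraction of an ideal of \<open>Q\<close>, namely of the
  classes of the polynomials with all coefficients in \<open>J\<close>. For if a constant \<open>r\<close> agrees with such a
  polynomial modulo a multiple \<open>f(t^2 + at + b)\<close>, then this multiple is constant modulo \<open>J\<close>; the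
  divisor being monic, \<open>f\<close> vanishes modulo \<open>J\<close>, and therefore \<open>r \<in> J\<close>
  (\<open>constant_multiple_of_quad_poly\<close>). So distinct ideals of \<open>R\<close> have distinct extensions to \<open>Q\<close>, and
  the chain condition descends (\<open>noetherian_ring_if_ideals_contracted\<close>).
\<close>

section \<open>Transfer of the Noetherian property\<close>

text \<open>
  A chain of ideals of \<open>S\<close> is mapped by \<open>F\<close> and by \<open>G\<close> to chains of ideals of \<open>R\<close>, each of which
  attains its union. The larger of the two members where this happens is the largest member of the
  chain, since nested ideals of \<open>S\<close> are separated by \<open>F\<close> and \<open>G\<close>.
  The case \<open>F = G\<close> serves for the descent from an extension ring.
\<close>
lemma noetherian_ring_by_two_ideal_maps:
  fixes F G :: "'b set \<Rightarrow> 'a set"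
  assumes noeth: "noetherian_ring R" and S: "ring S"
    and ideals: "\<And>K. ideal K S \<Longrightarrow> ideal (F K) R" "\<And>K. ideal K S \<Longrightarrow> ideal (G K) R"
    and mono: "\<And>K L. K \<subseteq> L \<Longrightarrow> F K \<subseteq> F L" "\<And>K L. K \<subseteq> L \<Longrightarrow> G K \<subseteq> G L"
    and determined: "\<And>K L. \<lbrakk>ideal K S; ideal L S; K \<subseteq> L; F L \<subseteq> F K; G L \<subseteq> G K\<rbrakk> \<Longrightarrow> L \<subseteq> K"
  shows "noetherian_ring S"
proof (rule ring.trivial_ideal_chain_imp_noetherian[OF S])
  fix C assume nonempty: "C \<noteq> {}" and chain: "subset.chain {K. ideal K S} C"
  have ideal: "ideal K S" if "K \<in> C" for K
    using chain that by (auto simp: pred_on.chain_def)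
  have total: "K \<subseteq> L \<or> L \<subseteq> K" if "K \<in> C" "L \<in> C" for K L
    using chain that by (auto simp: pred_on.chain_def)
  have attained: "\<exists>K\<in>C. \<forall>L\<in>C. H L \<subseteq> H K"
    if ideals: "\<And>K. ideal K S \<Longrightarrow> ideal (H K) R"
      and mono: "\<And>K L. K \<subseteq> L \<Longrightarrow> H K \<subseteq> H L" for H :: "'b set \<Rightarrow> 'a set"
  proof -
    have "subset.chain {J. ideal J R} (H ` C)"
      unfolding pred_on.chain_def
    proof (intro conjI ballI)
      show "H ` C \<subseteq> {J. ideal J R}" by (auto intro: ideals ideal)
      fix X Y assume "X \<in> H ` C" "Y \<in> H ` C"
      then obtain K L where KL: "K \<in> C" "L \<in> C" "X = H K" "Y = H L" by auto
      with total[OF KL(1,2)] mono[of K L] mono[of L K] show "(\<subset>)\<^sup>=\<^sup>= X Y \<or> (\<subset>)\<^sup>=\<^sup>= Y X"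
        by auto
    qed
    then have "\<Union>(H ` C) \<in> H ` C"
      by (rule noetherian_ring.ideal_chain_is_trivial[OF noeth, rotated]) (use nonempty in simp)
    then show ?thesis by auto
  qed
  obtain K where K: "K \<in> C" "\<And>L. L \<in> C \<Longrightarrow> F L \<subseteq> F K"
    using attained[of F, OF ideals(1) mono(1)] by auto
  obtain K' where K': "K' \<in> C" "\<And>L. L \<in> C \<Longrightarrow> G L \<subseteq> G K'"
    using attained[of G, OF ideals(2) mono(2)] by auto
  obtain M where M: "M \<in> C" "K \<subseteq> M" "K' \<subseteq> M"
    using total[OF K(1) K'(1)] K(1) K'(1) by blast
  have "L \<subseteq> M" if L: "L \<in> C" for L
  proof (cases "L \<subseteq> M")
    case False
    then have "M \<subseteq> L" using total[OF L M(1)] by blast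
    moreover have "F L \<subseteq> F M" "G L \<subseteq> G M"
      using K(2)[OF L] K'(2)[OF L] mono(1)[OF M(2)] mono(2)[OF M(3)] by auto
    ultimately show ?thesis
      using determined[OF ideal[OF M(1)] ideal[OF L]] by blast
  qed
  then have "\<Union>C = M" using M(1) by blast
  then show "\<Union>C \<in> C" using M(1) by simp
qed

text \<open>
  If \<open>J\<close> is the contraction of some ideal \<open>K\<close> then it is also the contraction of the ideal generated by
  its image, as this lies inside \<open>K\<close>. Thus extension of ideals is monotone and reflects inclusions.
\<close>
lemma noetherian_ring_if_ideals_contracted:
  assumes S: "noetherian_ring S" and R: "ring R" and h: "h \<in> ring_hom R S"
    and contracted: "\<And>J. ideal J R \<Longrightarrow> \<exists>K. ideal K S \<and> (\<forall>r\<in>carrier R. h r \<in> K \<longleftrightarrow> r \<in> J)"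
  shows "noetherian_ring R"
proof -
  interpret S: noetherian_ring S by fact
  have img: "h ` (J \<inter> carrier R) \<subseteq> carrier S" for J
    using ring_hom_closed[OF h] by blast
  let ?E = "\<lambda>J. Idl\<^bsub>S\<^esub> (h ` (J \<inter> carrier R))"
  have ideal: "ideal (?E J) S" for J
    by (rule S.genideal_ideal[OF img])
  have mono: "?E J \<subseteq> ?E J'" if "J \<subseteq> J'" for J J'
  proof (rule S.genideal_minimal[OF ideal])
    show "h ` (J \<inter> carrier R) \<subseteq> ?E J'"
      using S.genideal_self[OF img, of J'] that by blast
  qed
  have reflects: "J' \<subseteq> J" if J: "ideal J R" "ideal J' R" and le: "?E J' \<subseteq> ?E J" for J J'
  proof
    fix r assume r: "r \<in> J'"
    then have rc: "r \<in> carrier R" using J(2) ideal.Icarr by fast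
    obtain K where K: "ideal K S" "\<forall>r\<in>carrier R. h r \<in> K \<longleftrightarrow> r \<in> J"
      using contracted[OF J(1)] by blast
    have "?E J \<subseteq> K"
      by (rule S.genideal_minimal[OF K(1)]) (use K(2) in blast)
    moreover have "h r \<in> ?E J'"
      using S.genideal_self[OF img, of J'] r rc by blast
    ultimately show "r \<in> J" using K(2) rc le by blast
  qed
  show ?thesis
  proof (rule noetherian_ring_by_two_ideal_maps[OF S R, of ?E ?E])
    fix J J' assume "ideal J R" "ideal J' R" "?E J' \<subseteq> ?E J"
    then show "J' \<subseteq> J" by (rule reflects)
  qed (rule ideal mono; assumption)+
qed

text \<open>
  The hypotheses make \<open>(r, i) \<mapsto> h r + g i\<close> a surjection of \<open>R\<close>-bimodules from \<open>R \<oplus> I\<close> onto \<open>S\<close>.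
  Pull an ideal \<open>K\<close> of \<open>S\<close> back to a submodule of \<open>R \<oplus> I\<close>. Its intersection with the first summand
  and its projection to the second are ideals of \<open>R\<close>, and nested submodules that agree in both are
  equal, as in any extension of modules.
\<close>
lemma noetherian_ring_if_sum_of_ring_and_ideal:
  assumes R: "noetherian_ring R" and I: "ideal I R" and S: "ring S"
    and h: "h \<in> ring_hom R S"
    and g: "\<And>i. i \<in> I \<Longrightarrow> g i \<in> carrier S"
    and g_add: "\<And>i j. \<lbrakk>i \<in> I; j \<in> I\<rbrakk> \<Longrightarrow> g (i \<oplus>\<^bsub>R\<^esub> j) = g i \<oplus>\<^bsub>S\<^esub> g j"
    and g_left: "\<And>r i. \<lbrakk>r \<in> carrier R; i \<in> I\<rbrakk> \<Longrightarrow> g (r \<otimes>\<^bsub>R\<^esub> i) = h r \<otimes>\<^bsub>S\<^esub> g i"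
    and g_right: "\<And>r i. \<lbrakk>r \<in> carrier R; i \<in> I\<rbrakk> \<Longrightarrow> g (i \<otimes>\<^bsub>R\<^esub> r) = g i \<otimes>\<^bsub>S\<^esub> h r"
    and onto: "\<And>s. s \<in> carrier S \<Longrightarrow> \<exists>r\<in>carrier R. \<exists>i\<in>I. s = h r \<oplus>\<^bsub>S\<^esub> g i"
  shows "noetherian_ring S"
proof -
  interpret R: noetherian_ring R by fact
  interpret S: ring S by fact
  interpret I: ideal I R by fact
  interpret h: ring_hom_ring R S h
    by (rule ring_hom_ringI2[OF R.ring_axioms S h])
  let ?F = "\<lambda>K. {r \<in> carrier R. h r \<in> K}"
  let ?G = "\<lambda>K. {i \<in> I. \<exists>r\<in>carrier R. h r \<oplus>\<^bsub>S\<^esub> g i \<in> K}"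
  have ideal_G: "ideal (?G K) R" if "ideal K S" for K
  proof -
    interpret K: ideal K S by fact
    have scale: "r \<otimes>\<^bsub>R\<^esub> i \<in> ?G K" "i \<otimes>\<^bsub>R\<^esub> r \<in> ?G K" if "i \<in> ?G K" and r: "r \<in> carrier R" for i r
    proof -
      obtain s where s: "i \<in> I" "s \<in> carrier R" "h s \<oplus>\<^bsub>S\<^esub> g i \<in> K" using \<open>i \<in> ?G K\<close> by blast
      have "h r \<otimes>\<^bsub>S\<^esub> (h s \<oplus>\<^bsub>S\<^esub> g i) \<in> K" "(h s \<oplus>\<^bsub>S\<^esub> g i) \<otimes>\<^bsub>S\<^esub> h r \<in> K"
        using K.I_l_closed[OF s(3)] K.I_r_closed[OF s(3)] r by simp_all
      then have "h (r \<otimes>\<^bsub>R\<^esub> s) \<oplus>\<^bsub>S\<^esub> g (r \<otimes>\<^bsub>R\<^esub> i) \<in> K" "h (s \<otimes>\<^bsub>R\<^esub> r) \<oplus>\<^bsub>S\<^esub> g (i \<otimes>\<^bsub>R\<^esub> r) \<in> K"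
        using s r g by (simp_all add: S.r_distr S.l_distr g_left g_right)
      then show "r \<otimes>\<^bsub>R\<^esub> i \<in> ?G K" "i \<otimes>\<^bsub>R\<^esub> r \<in> ?G K"
        using s r I.I_l_closed I.I_r_closed by blast+
    qed
    show ?thesis
    proof (rule idealI[OF R.ring_axioms])
      show "subgroup (?G K) (add_monoid R)"
      proof (rule R.add.subgroupI)
        show "?G K \<subseteq> carrier R" by auto
        have "g \<zero>\<^bsub>R\<^esub> = h \<zero>\<^bsub>R\<^esub> \<otimes>\<^bsub>S\<^esub> g \<zero>\<^bsub>R\<^esub>"
          using g_left[OF R.zero_closed I.zero_closed] by simp
        then have "h \<zero>\<^bsub>R\<^esub> \<oplus>\<^bsub>S\<^esub> g \<zero>\<^bsub>R\<^esub> \<in> K"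
          using g[OF I.zero_closed] K.zero_closed by simp
        then show "?G K \<noteq> {}" using I.zero_closed R.zero_closed by blast
        fix i assume i: "i \<in> ?G K"
        have "\<ominus>\<^bsub>R\<^esub> i = (\<ominus>\<^bsub>R\<^esub> \<one>\<^bsub>R\<^esub>) \<otimes>\<^bsub>R\<^esub> i" using i by (simp add: R.l_minus)
        then show "\<ominus>\<^bsub>R\<^esub> i \<in> ?G K" using scale(1)[OF i, of "\<ominus>\<^bsub>R\<^esub> \<one>\<^bsub>R\<^esub>"] by simp
        fix j assume "j \<in> ?G K"
        with i obtain r s where rs: "i \<in> I" "j \<in> I" "r \<in> carrier R" "s \<in> carrier R"
          "h r \<oplus>\<^bsub>S\<^esub> g i \<in> K" "h s \<oplus>\<^bsub>S\<^esub> g j \<in> K" by blast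
        have "h (r \<oplus>\<^bsub>R\<^esub> s) \<oplus>\<^bsub>S\<^esub> g (i \<oplus>\<^bsub>R\<^esub> j) = (h r \<oplus>\<^bsub>S\<^esub> g i) \<oplus>\<^bsub>S\<^esub> (h s \<oplus>\<^bsub>S\<^esub> g j)"
          using rs(1-4) g by (simp add: g_add S.a_ac)
        then have "h (r \<oplus>\<^bsub>R\<^esub> s) \<oplus>\<^bsub>S\<^esub> g (i \<oplus>\<^bsub>R\<^esub> j) \<in> K"
          using K.a_closed rs(5,6) by simp
        then show "i \<oplus>\<^bsub>R\<^esub> j \<in> ?G K" using rs I.a_closed R.a_closed by blast
      qed
    qed (use scale in blast)+
  qed
  have determined: "L \<subseteq> K"
    if "ideal K S" "ideal L S" and le: "K \<subseteq> L" "?F L \<subseteq> ?F K" "?G L \<subseteq> ?G K" for K L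
  proof
    interpret K: ideal K S by fact
    interpret L: ideal L S by fact
    fix x assume x: "x \<in> L"
    obtain r i where ri: "r \<in> carrier R" "i \<in> I" "x = h r \<oplus>\<^bsub>S\<^esub> g i"
      using onto[OF L.Icarr[OF x]] by blast
    then have "i \<in> ?G K" using x le(3) by blast
    then obtain s where s: "s \<in> carrier R" "h s \<oplus>\<^bsub>S\<^esub> g i \<in> K" by blast
    \<comment> \<open>An element of \<open>K\<close> with the same second component \<open>i\<close> as \<open>x\<close> differs from it by a constant.\<close>
    have "h (r \<ominus>\<^bsub>R\<^esub> s) = h r \<ominus>\<^bsub>S\<^esub> h s"
      using ri(1) s(1) by (simp add: a_minus_def)
    also have "\<dots> = (h r \<oplus>\<^bsub>S\<^esub> g i) \<ominus>\<^bsub>S\<^esub> (h s \<oplus>\<^bsub>S\<^esub> g i)"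
      using h.hom_closed[OF ri(1)] h.hom_closed[OF s(1)] g[OF ri(2)]
      by (simp add: a_minus_def S.minus_add S.a_assoc S.r_neg2 S.a_comm[of _ "\<ominus>\<^bsub>S\<^esub> g i"])
    also have "\<dots> = x \<ominus>\<^bsub>S\<^esub> (h s \<oplus>\<^bsub>S\<^esub> g i)"
      by (simp add: ri(3))
    also have "\<dots> \<in> L"
      using x s(2) le(1) by (simp add: a_minus_def L.a_closed L.a_inv_closed subsetD)
    finally have "r \<ominus>\<^bsub>R\<^esub> s \<in> ?F K" using le(2) ri(1) s(1) by blast
    then have "h (r \<ominus>\<^bsub>R\<^esub> s) \<oplus>\<^bsub>S\<^esub> (h s \<oplus>\<^bsub>S\<^esub> g i) \<in> K"
      using K.a_closed s(2) by blast
    moreover have "h (r \<ominus>\<^bsub>R\<^esub> s) \<oplus>\<^bsub>S\<^esub> (h s \<oplus>\<^bsub>S\<^esub> g i) = x"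
      using ri s(1) g[OF ri(2)]
      by (simp add: a_minus_def S.a_assoc S.r_neg1)
    ultimately show "x \<in> K" by simp
  qed
  show ?thesis
  proof (rule noetherian_ring_by_two_ideal_maps[OF R S, of ?F ?G])
    fix K L assume "ideal K S" "ideal L S" "K \<subseteq> L" "?F L \<subseteq> ?F K" "?G L \<subseteq> ?G K"
    then show "L \<subseteq> K" by (rule determined)
  next
    show "ideal (?F K) R" "ideal (?G K) R" if "ideal K S" for K
      using that by (rule h.ideal_vimage, rule ideal_G)
  qed auto
qed


section \<open>Multiples of a monic quadratic polynomial\<close>

context UP_cring
begin

lemma coeff_mult_quad_poly:
  assumes f: "f \<in> carrier P" and a: "a \<in> carrier R" and b: "b \<in> carrier R"
  shows "coeff P (f \<otimes>\<^bsub>P\<^esub> quad_poly R a b) 0 = b \<otimes> coeff P f 0" (is ?zero)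
    and "coeff P (f \<otimes>\<^bsub>P\<^esub> quad_poly R a b) (Suc 0)
      = a \<otimes> coeff P f 0 \<oplus> b \<otimes> coeff P f (Suc 0)" (is ?one)
    and "coeff P (f \<otimes>\<^bsub>P\<^esub> quad_poly R a b) (Suc (Suc n))
      = coeff P f n \<oplus> a \<otimes> coeff P f (Suc n) \<oplus> b \<otimes> coeff P f (Suc (Suc n))" (is ?two)
proof -
  have low: "coeff P (monom P c k \<otimes>\<^bsub>P\<^esub> f) m = \<zero>" if "m < k" "c \<in> carrier R" for c k m
  proof -
    have "coeff P (monom P c k \<otimes>\<^bsub>P\<^esub> f) m = (\<Oplus>i\<in>{..m}. \<zero>)"
      unfolding coeff_mult[OF monom_closed[OF that(2)] f]
      by (rule R.finsum_cong') (use that f in auto)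
    then show ?thesis by simp
  qed
  have prod: "f \<otimes>\<^bsub>P\<^esub> quad_poly R a b
    = monom P \<one> 2 \<otimes>\<^bsub>P\<^esub> f \<oplus>\<^bsub>P\<^esub> monom P a 1 \<otimes>\<^bsub>P\<^esub> f \<oplus>\<^bsub>P\<^esub> monom P b 0 \<otimes>\<^bsub>P\<^esub> f"
    using f a b unfolding quad_poly_def P_def[symmetric]
    by (simp add: P.r_distr P.m_comm)
  have shift: "coeff P (f \<otimes>\<^bsub>P\<^esub> quad_poly R a b) n = coeff P (monom P \<one> 2 \<otimes>\<^bsub>P\<^esub> f) n
     \<oplus> coeff P (monom P a 1 \<otimes>\<^bsub>P\<^esub> f) n \<oplus> coeff P (monom P b 0 \<otimes>\<^bsub>P\<^esub> f) n" for n
    unfolding prod using f a b by (simp del: coeff_mult)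
  note up = coeff_monom_mult[OF R.one_closed f, of 2 n] coeff_monom_mult[OF a f, of 1]
    coeff_monom_mult[OF b f, of 0]
  show ?zero ?one ?two
    unfolding shift
    using up(1) up(2)[of 0] up(2)[of "Suc n"] up(3)[of 0] up(3)[of "Suc 0"] up(3)[of "Suc (Suc n)"]
      low[of 0 2 \<one>] low[of "Suc 0" 2 \<one>] low[of 0 1 a] f a b
    by (simp_all del: coeff_mult)
qed

lemma quad_poly_closed:
  "\<lbrakk>a \<in> carrier R; b \<in> carrier R\<rbrakk> \<Longrightarrow> quad_poly R a b \<in> carrier P"
  unfolding quad_poly_def P_def[symmetric] by simp

text \<open>
  Modulo \<open>J\<close> the product is a constant. The leading coefficient of the quadratic factor is \<open>1\<close>, so the
  coefficients of \<open>f\<close> lie in \<open>J\<close> one after the other, from the top down.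
\<close>
lemma constant_multiple_of_quad_poly:
  assumes J: "ideal J R" and f: "f \<in> carrier P" and a: "a \<in> carrier R" and b: "b \<in> carrier R"
    and high: "\<And>n. coeff P (f \<otimes>\<^bsub>P\<^esub> quad_poly R a b) (Suc n) \<in> J"
  shows "coeff P (f \<otimes>\<^bsub>P\<^esub> quad_poly R a b) 0 \<in> J"
proof -
  interpret J: ideal J R by fact
  have descend: "coeff P f n \<in> J" if "coeff P f (Suc n) \<in> J" "coeff P f (Suc (Suc n)) \<in> J" for n
  proof -
    let ?y = "a \<otimes> coeff P f (Suc n) \<oplus> b \<otimes> coeff P f (Suc (Suc n))"
    have y: "?y \<in> J"
      using that a b by (simp add: J.I_l_closed J.a_closed)
    have "coeff P f n \<oplus> ?y \<in> J"
      using high[of "Suc n"] f a b by (simp add: coeff_mult_quad_poly R.a_assoc del: coeff_mult)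
    then have "(coeff P f n \<oplus> ?y) \<oplus> \<ominus> ?y \<in> J"
      using y J.a_closed J.a_inv_closed by blast
    also have "(coeff P f n \<oplus> ?y) \<oplus> \<ominus> ?y = coeff P f n"
      using f y J.Icarr by (simp add: R.a_assoc R.r_neg del: R.minus_add)
    finally show ?thesis .
  qed
  have "coeff P f n \<in> J \<and> coeff P f (Suc n) \<in> J" if "n \<le> Suc (deg R f)" for n
    using that
  proof (induction n rule: inc_induct)
    case base
    then show ?case using f by (simp add: deg_aboveD)
  next
    case (step n)
    then show ?case using descend[of n] by simp
  qed
  from this[of 0] show ?thesis
    using f a b by (simp add: coeff_mult_quad_poly J.I_l_closed del: coeff_mult)
qed

text \<open>
  Division with remainder, keeping track of \<open>I\<close>: subtracting \<open>c t^d (t^2 + at + b)\<close> to cancel the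
  leading term \<open>c t^(d+2)\<close> changes the lower coefficients by multiples of \<open>c \<in> I\<close>, so the
  coefficients in positive degree never leave \<open>I\<close>. The quotient \<open>f\<close> is only a polynomial over \<open>R\<close>,
  which suffices because the ideal of the Rees algebra is defined by contraction from \<open>R[t]\<close>.
\<close>
lemma linear_remainder_mod_quad_poly:
  assumes I: "ideal I R" and a: "a \<in> carrier R" and b: "b \<in> carrier R"
    and p: "p \<in> carrier P" "\<And>n. coeff P p (Suc n) \<in> I"
  shows "\<exists>r\<in>carrier R. \<exists>i\<in>I. \<exists>f\<in>carrier P.
    p = monom P r 0 \<oplus>\<^bsub>P\<^esub> monom P i 1 \<oplus>\<^bsub>P\<^esub> f \<otimes>\<^bsub>P\<^esub> quad_poly R a b"
proof -
  interpret I: ideal I R by fact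
  note q = quad_poly_closed[OF a b]
  \<comment> \<open>The degree bound is \<open>Suc d\<close>, so that \<open>d = 0\<close> is the case of a polynomial that is already linear.\<close>
  have "\<exists>r\<in>carrier R. \<exists>i\<in>I. \<exists>f\<in>carrier P.
      p = monom P r 0 \<oplus>\<^bsub>P\<^esub> monom P i 1 \<oplus>\<^bsub>P\<^esub> f \<otimes>\<^bsub>P\<^esub> quad_poly R a b"
    if "p \<in> carrier P" "\<And>n. coeff P p (Suc n) \<in> I" "\<And>m. Suc d < m \<Longrightarrow> coeff P p m = \<zero>" for d p
    using that
  proof (induction d arbitrary: p)
    case 0
    have "p = monom P (coeff P p 0) 0 \<oplus>\<^bsub>P\<^esub> monom P (coeff P p 1) 1
        \<oplus>\<^bsub>P\<^esub> \<zero>\<^bsub>P\<^esub> \<otimes>\<^bsub>P\<^esub> quad_poly R a b"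
    proof (rule up_eqI)
      fix n
      consider "n = 0" | "n = 1" | "Suc 0 < n" by linarith
      then show "coeff P p n = coeff P (monom P (coeff P p 0) 0 \<oplus>\<^bsub>P\<^esub> monom P (coeff P p 1) 1
        \<oplus>\<^bsub>P\<^esub> \<zero>\<^bsub>P\<^esub> \<otimes>\<^bsub>P\<^esub> quad_poly R a b) n"
        by cases (use 0 q in \<open>simp_all del: coeff_mult\<close>)
    qed (use 0 q in simp_all)
    then show ?case using 0 by (metis One_nat_def UP_zero_closed coeff_closed)
  next
    case (Suc d)
    define c where "c = coeff P p (Suc (Suc d))"
    have c: "c \<in> I" "c \<in> carrier R" using Suc.prems(1,2) by (simp_all add: c_def)
    define p' where "p' = p \<oplus>\<^bsub>P\<^esub> monom P (\<ominus> c) d \<otimes>\<^bsub>P\<^esub> quad_poly R a b"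
    have p': "p' \<in> carrier P" using Suc.prems(1) c q by (simp add: p'_def)
    have coeffs: "coeff P p' k = coeff P p k
        \<oplus> coeff P (monom P (\<ominus> c) d \<otimes>\<^bsub>P\<^esub> quad_poly R a b) k" for k
      unfolding p'_def using Suc.prems(1) c q by (simp del: coeff_mult)
    have inI: "coeff P p' (Suc n) \<in> I" for n
      unfolding coeffs
      using Suc.prems(2)[of n] c a b
      by (cases n) (simp_all add: coeff_mult_quad_poly I.I_l_closed I.a_closed del: coeff_mult)
    have small: "coeff P p' m = \<zero>" if "Suc d < m" for m
    proof -
      obtain k where k: "m = Suc (Suc k)" "d \<le> k"
        using \<open>Suc d < m\<close> by (cases m; cases "m - 1") auto
      then show ?thesis
        unfolding coeffs
        using c a b Suc.prems(3)[of m] 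
        by (cases "d = k") (simp_all add: coeff_mult_quad_poly c_def R.r_neg del: coeff_mult)
    qed
    obtain r i f where rif: "r \<in> carrier R" "i \<in> I" "f \<in> carrier P"
      "p' = monom P r 0 \<oplus>\<^bsub>P\<^esub> monom P i 1 \<oplus>\<^bsub>P\<^esub> f \<otimes>\<^bsub>P\<^esub> quad_poly R a b"
      using Suc.IH[OF p' inI small] by blast
    have "p = p' \<oplus>\<^bsub>P\<^esub> monom P c d \<otimes>\<^bsub>P\<^esub> quad_poly R a b"
      unfolding p'_def using Suc.prems(1) c q
      by (simp add: P.a_assoc P.l_minus P.l_neg)
    also have "\<dots> = monom P r 0 \<oplus>\<^bsub>P\<^esub> monom P i 1
        \<oplus>\<^bsub>P\<^esub> (f \<oplus>\<^bsub>P\<^esub> monom P c d) \<otimes>\<^bsub>P\<^esub> quad_poly R a b"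
      unfolding rif(4) using rif(1-3) c q by (simp add: P.a_assoc P.l_distr)
    finally show ?case
      using rif c by (metis UP_a_closed monom_closed)
  qed
  from this[of p "deg R p"] show ?thesis using p deg_aboveD by simp
qed

end


section \<open>The Rees algebra and its quotient\<close>

lemma (in ring) finsum_in_ideal:
  assumes "ideal J R" "finite A" "\<And>x. x \<in> A \<Longrightarrow> f x \<in> J"
  shows "(\<Oplus>x\<in>A. f x) \<in> J"
proof -
  interpret J: ideal J R by fact
  show ?thesis using assms(2,3)
  proof (induction A)
    case (insert x A)
    then show ?case using J.Icarr J.a_closed by (subst finsum_insert) auto
  qed simp
qed

context cring
begin

lemma ideal_nat_pow:
  assumes "ideal I R"
  shows "ideal (I [^]\<^bsub>ideals_set R\<^esub> (n::nat)) R"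
proof -
  interpret ideals: comm_monoid "ideals_set R" by (rule ideals_set_is_comm_monoid)
  show ?thesis
    using ideals.nat_pow_closed[of I n] assms by (simp add: ideals_set_def)
qed

lemma ideal_nat_pow_low_exponents:
  assumes "ideal I R"
  shows "I [^]\<^bsub>ideals_set R\<^esub> (0::nat) = carrier R"
    and "I [^]\<^bsub>ideals_set R\<^esub> Suc 0 = I"
    and ideal_nat_pow_Suc_subset: "I [^]\<^bsub>ideals_set R\<^esub> Suc n \<subseteq> I"
proof -
  interpret ideals: comm_monoid "ideals_set R" by (rule ideals_set_is_comm_monoid)
  show "I [^]\<^bsub>ideals_set R\<^esub> (0::nat) = carrier R"
    using ideals.nat_pow_0[of I] by (simp add: ideals_set_def)
  show "I [^]\<^bsub>ideals_set R\<^esub> Suc 0 = I"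
    using ideals.nat_pow_eone[of I] assms by (simp add: ideals_set_def)
  have "I [^]\<^bsub>ideals_set R\<^esub> Suc n = ideal_prod R (I [^]\<^bsub>ideals_set R\<^esub> n) I"
    using ideals.nat_pow_Suc[of I n] by (simp add: ideals_set_def)
  then show "I [^]\<^bsub>ideals_set R\<^esub> Suc n \<subseteq> I"
    using ideal_prod_inter[OF ideal_nat_pow[OF assms] assms] by blast
qed

lemma ideal_nat_pow_mult:
  assumes I: "ideal I R" and x: "x \<in> I [^]\<^bsub>ideals_set R\<^esub> (m::nat)" and y: "y \<in> I [^]\<^bsub>ideals_set R\<^esub> (n::nat)"
  shows "x \<otimes> y \<in> I [^]\<^bsub>ideals_set R\<^esub> (m + n)"
proof -
  interpret ideals: comm_monoid "ideals_set R" by (rule ideals_set_is_comm_monoid)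
  have "ideal_prod R (I [^]\<^bsub>ideals_set R\<^esub> m) (I [^]\<^bsub>ideals_set R\<^esub> n) = I [^]\<^bsub>ideals_set R\<^esub> (m + n)"
    using ideals.nat_pow_mult[of I m n] I by (simp add: ideals_set_def)
  then show ?thesis using ideal_prod.prod[OF x y, of R] by simp
qed

end

locale quadratic_rees_quotient = UP_cring +
  fixes I :: "'a set" and a b :: 'a
  assumes ideal_I: "ideal I R" and a_closed: "a \<in> carrier R" and b_closed: "b \<in> carrier R"
begin

abbreviation "A \<equiv> rees_algebra R I"
abbreviation "N \<equiv> rees_quad_ideal R I a b"
abbreviation "Q \<equiv> rees_quotient R I a b"

lemma rees_algebra_sel [simp]:
  "p \<otimes>\<^bsub>A\<^esub> p' = p \<otimes>\<^bsub>P\<^esub> p'" "p \<oplus>\<^bsub>A\<^esub> p' = p \<oplus>\<^bsub>P\<^esub> p'" "\<one>\<^bsub>A\<^esub> = \<one>\<^bsub>P\<^esub>" "\<zero>\<^bsub>A\<^esub> = \<zero>\<^bsub>P\<^esub>"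
  by (simp_all add: rees_algebra_def P_def)

lemma mem_rees_algebra_iff:
  "p \<in> carrier A \<longleftrightarrow> p \<in> carrier P \<and> (\<forall>n. coeff P p n \<in> I [^]\<^bsub>ideals_set R\<^esub> n)"
  by (simp add: rees_algebra_def P_def)

lemma ideal_pow: "ideal (I [^]\<^bsub>ideals_set R\<^esub> (n::nat)) R"
  by (rule R.ideal_nat_pow[OF ideal_I])

lemma cring_rees_algebra: "cring A"
proof -
  have "subring (carrier A) P"
  proof (rule P.subringI)
    have "\<one> \<in> I [^]\<^bsub>ideals_set R\<^esub> (0::nat)"
      by (simp only: R.ideal_nat_pow_low_exponents(1)[OF ideal_I] R.one_closed)
    then show "\<one>\<^bsub>P\<^esub> \<in> carrier A"
      using additive_subgroup.zero_closed[OF ideal.axioms(1)[OF ideal_pow]]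
      by (simp add: mem_rees_algebra_iff)
    fix p assume p: "p \<in> carrier A"
    show "\<ominus>\<^bsub>P\<^esub> p \<in> carrier A"
      using p additive_subgroup.a_inv_closed[OF ideal.axioms(1)[OF ideal_pow]]
      by (simp add: mem_rees_algebra_iff)
    fix p' assume p': "p' \<in> carrier A"
    show "p \<oplus>\<^bsub>P\<^esub> p' \<in> carrier A"
      using p p' additive_subgroup.a_closed[OF ideal.axioms(1)[OF ideal_pow]]
      by (simp add: mem_rees_algebra_iff)
    have "coeff P (p \<otimes>\<^bsub>P\<^esub> p') n \<in> I [^]\<^bsub>ideals_set R\<^esub> n" for n
    proof -
      have "coeff P p i \<otimes> coeff P p' (n - i) \<in> I [^]\<^bsub>ideals_set R\<^esub> n" if "i \<le> n" for i
        using R.ideal_nat_pow_mult[OF ideal_I, of "coeff P p i" i "coeff P p' (n - i)" "n - i"] p p' that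
        by (simp add: mem_rees_algebra_iff)
      then have "(\<Oplus>i\<in>{..n}. coeff P p i \<otimes> coeff P p' (n - i)) \<in> I [^]\<^bsub>ideals_set R\<^esub> n"
        by (intro R.finsum_in_ideal[OF ideal_pow]) auto
      then show ?thesis
        using p p' by (simp add: mem_rees_algebra_iff)
    qed
    then show "p \<otimes>\<^bsub>P\<^esub> p' \<in> carrier A"
      using p p' by (simp add: mem_rees_algebra_iff del: coeff_mult)
  qed (auto simp: mem_rees_algebra_iff)
  then have "cring (P\<lparr>carrier := carrier A\<rparr>)"
    using P.subcringI' P.subcring_iff subringE(1) by blast
  also have "P\<lparr>carrier := carrier A\<rparr> = A"
    by (simp add: rees_algebra_def P_def)
  finally show ?thesis .
qed

lemma mem_rees_quad_ideal_iff:
  "p \<in> N \<longleftrightarrow> p \<in> carrier A \<and> (\<exists>f\<in>carrier P. p = f \<otimes>\<^bsub>P\<^esub> quad_poly R a b)"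
  unfolding rees_quad_ideal_def cgenideal_def P_def by auto

text \<open>
  With the inclusion as a ring homomorphism, contraction to the Rees algebra is an inverse image, so
  contracted ideals are ideals.
\<close>
lemma rees_algebra_inclusion: "ring_hom_ring A P (\<lambda>p. p)"
  by (rule ring_hom_ringI2[OF cring.axioms(1)[OF cring_rees_algebra] P.ring_axioms])
    (auto intro!: ring_hom_memI simp: mem_rees_algebra_iff)

lemma ideal_rees_quad_ideal: "ideal N A"
proof -
  have "ideal (PIdl\<^bsub>P\<^esub> quad_poly R a b) P"
    by (rule P.cgenideal_ideal[OF quad_poly_closed[OF a_closed b_closed]])
  from ring_hom_ring.ideal_vimage[OF rees_algebra_inclusion this]
  show ?thesis
    unfolding rees_quad_ideal_def P_def
    by (simp add: Int_def conj_commute)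
qed

lemma rees_quotient_eq: "Q = A Quot N"
  by (simp add: rees_quotient_def)

lemma monom_in_rees_algebra:
  assumes "r \<in> I [^]\<^bsub>ideals_set R\<^esub> n"
  shows "monom P r n \<in> carrier A"
  using assms ideal.Icarr[OF ideal_pow assms]
    additive_subgroup.zero_closed[OF ideal.axioms(1)[OF ideal_pow]]
  by (auto simp: mem_rees_algebra_iff)

lemma const_in_rees_algebra: "r \<in> carrier R \<Longrightarrow> monom P r 0 \<in> carrier A"
  by (rule monom_in_rees_algebra) (simp only: R.ideal_nat_pow_low_exponents[OF ideal_I] One_nat_def)

lemma linear_in_rees_algebra: "i \<in> I \<Longrightarrow> monom P i 1 \<in> carrier A"
  by (rule monom_in_rees_algebra) (simp only: R.ideal_nat_pow_low_exponents[OF ideal_I] One_nat_def)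

definition residue where "residue p = N +>\<^bsub>A\<^esub> p"

lemma residue_hom: "ring_hom_ring A Q residue"
  using ideal.rcos_ring_hom_ring[OF ideal_rees_quad_ideal]
  by (simp add: rees_quotient_eq residue_def[abs_def])

lemma residue_surj: "s \<in> carrier Q \<Longrightarrow> \<exists>p\<in>carrier A. s = residue p"
  by (auto simp: rees_quotient_eq residue_def FactRing_def A_RCOSETS_def')

lemma residue_constant_hom: "(\<lambda>r. residue (monom P r 0)) \<in> ring_hom R Q"
proof -
  interpret residue: ring_hom_ring A Q residue by (rule residue_hom)
  show ?thesis
  proof (rule ring_hom_memI)
    fix r s assume rs: "r \<in> carrier R" "s \<in> carrier R"
    note c = rs[THEN const_in_rees_algebra]
    show "residue (monom P r 0) \<in> carrier Q" using c by simp
    show "residue (monom P (r \<otimes> s) 0) = residue (monom P r 0) \<otimes>\<^bsub>Q\<^esub> residue (monom P s 0)"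
      using residue.hom_mult[OF c] monom_mult[OF rs, of 0 0] by simp
    show "residue (monom P (r \<oplus> s) 0) = residue (monom P r 0) \<oplus>\<^bsub>Q\<^esub> residue (monom P s 0)"
      using residue.hom_add[OF c] rs by simp
  next
    show "residue (monom P \<one> 0) = \<one>\<^bsub>Q\<^esub>" using residue.hom_one by simp
  qed
qed

text \<open>
  The remainder of the division by the quadratic polynomial lies in the Rees algebra. So does its
  difference from the given element, and this multiple of the quadratic polynomial therefore
  belongs to the contracted ideal.
\<close>
lemma residue_eq_linear:
  assumes s: "s \<in> carrier Q"
  shows "\<exists>r\<in>carrier R. \<exists>i\<in>I. s = residue (monom P r 0) \<oplus>\<^bsub>Q\<^esub> residue (monom P i 1)"
proof -
  interpret residue: ring_hom_ring A Q residue by (rule residue_hom)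
  interpret N: ideal N A by (rule ideal_rees_quad_ideal)
  obtain p where p: "p \<in> carrier A" "s = residue p" using residue_surj[OF s] by blast
  have pP: "p \<in> carrier P" "\<And>n. coeff P p (Suc n) \<in> I"
    using p(1) R.ideal_nat_pow_Suc_subset[OF ideal_I] unfolding mem_rees_algebra_iff by blast+
  obtain r i f where rif: "r \<in> carrier R" "i \<in> I" "f \<in> carrier P"
    "p = monom P r 0 \<oplus>\<^bsub>P\<^esub> monom P i 1 \<oplus>\<^bsub>P\<^esub> f \<otimes>\<^bsub>P\<^esub> quad_poly R a b"
    using linear_remainder_mod_quad_poly[OF ideal_I a_closed b_closed pP] by blast
  let ?l = "monom P r 0 \<oplus>\<^bsub>P\<^esub> monom P i 1" and ?z = "f \<otimes>\<^bsub>P\<^esub> quad_poly R a b"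
  have mon: "monom P r 0 \<in> carrier A" "monom P i 1 \<in> carrier A"
    using rif const_in_rees_algebra linear_in_rees_algebra by auto
  then have l: "?l \<in> carrier A" using residue.R.a_closed by fastforce
  have zP: "?z \<in> carrier P" using rif(3) quad_poly_closed[OF a_closed b_closed] by simp
  \<comment> \<open>The negative is taken in the Rees algebra, which exhibits the multiple \<open>?z\<close> as an element of it.\<close>
  have "?z = (\<ominus>\<^bsub>A\<^esub> ?l) \<oplus>\<^bsub>P\<^esub> p"
  proof -
    have "(\<ominus>\<^bsub>A\<^esub> ?l) \<oplus>\<^bsub>P\<^esub> ?l = \<zero>\<^bsub>P\<^esub>" using residue.R.l_neg[OF l] by simp
    moreover have "\<ominus>\<^bsub>A\<^esub> ?l \<in> carrier P" "?l \<in> carrier P"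
      using residue.R.a_inv_closed[OF l] l by (simp_all add: mem_rees_algebra_iff)
    ultimately show ?thesis using zP unfolding rif(4) by (metis P.a_assoc P.l_zero)
  qed
  then have "?z \<in> carrier A"
    using residue.R.a_closed[OF residue.R.a_inv_closed[OF l] p(1)] by simp
  then have z: "?z \<in> N" using rif(3) by (auto simp: mem_rees_quad_ideal_iff)
  then have "residue ?z = \<zero>\<^bsub>Q\<^esub>"
    by (simp add: residue_def rees_quotient_eq FactRing_def N.a_rcos_const)
  moreover have "residue p = residue ?l \<oplus>\<^bsub>Q\<^esub> residue ?z"
    using residue.hom_add[OF l N.Icarr[OF z]] rif(4) by simp
  ultimately have "s = residue ?l" using p(2) residue.hom_closed[OF l] by simp
  also have "\<dots> = residue (monom P r 0) \<oplus>\<^bsub>Q\<^esub> residue (monom P i 1)"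
    using residue.hom_add[OF mon] by simp
  finally show ?thesis using rif(1,2) by blast
qed

lemma noetherian_rees_quotient:
  assumes "noetherian_ring R"
  shows "noetherian_ring Q"
proof -
  interpret residue: ring_hom_ring A Q residue by (rule residue_hom)
  interpret I: ideal I R by (rule ideal_I)
  note const = const_in_rees_algebra and lin = linear_in_rees_algebra
  show ?thesis
  proof (rule noetherian_ring_if_sum_of_ring_and_ideal
      [OF assms ideal_I residue.S.ring_axioms residue_constant_hom,
        of "\<lambda>i. residue (monom P i 1)"])
    fix i assume i: "i \<in> I"
    show "residue (monom P i 1) \<in> carrier Q" using lin[OF i] by simp
    fix j assume j: "j \<in> I"
    show "residue (monom P (i \<oplus> j) 1) = residue (monom P i 1) \<oplus>\<^bsub>Q\<^esub> residue (monom P j 1)"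
      using residue.hom_add[OF lin[OF i] lin[OF j]] i j by simp
  next
    fix r i assume ri: "r \<in> carrier R" "i \<in> I"
    show "residue (monom P (r \<otimes> i) 1) = residue (monom P r 0) \<otimes>\<^bsub>Q\<^esub> residue (monom P i 1)"
      using residue.hom_mult[OF const[OF ri(1)] lin[OF ri(2)]] monom_mult[of r i 0 1] ri by simp
    show "residue (monom P (i \<otimes> r) 1) = residue (monom P i 1) \<otimes>\<^bsub>Q\<^esub> residue (monom P r 0)"
      using residue.hom_mult[OF lin[OF ri(2)] const[OF ri(1)]] monom_mult[of i r 1 0] ri by simp
  qed (rule residue_eq_linear)
qed

text \<open>
  The witness is the image of the polynomials in the Rees algebra whose coefficients all lie in \<open>J\<close>.
  A constant \<open>r\<close> congruent to such a polynomial belongs to \<open>J\<close> because the two differ by a multiple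
  of the quadratic polynomial that is constant modulo \<open>J\<close>.
\<close>
lemma ideal_contracted_from_rees_quotient:
  assumes J: "ideal J R"
  shows "\<exists>K. ideal K Q \<and> (\<forall>r\<in>carrier R. residue (monom P r 0) \<in> K \<longleftrightarrow> r \<in> J)"
proof -
  interpret residue: ring_hom_ring A Q residue by (rule residue_hom)
  interpret N: ideal N A by (rule ideal_rees_quad_ideal)
  interpret J: ideal J R by (rule J)
  let ?L = "{p \<in> carrier A. \<forall>n. coeff P p n \<in> J}"
  have JP: "ideal {p \<in> carrier P. \<forall>n. coeff P p n \<in> J} P"
  proof (rule idealI[OF P.ring_axioms])
    show "subgroup {p \<in> carrier P. \<forall>n. coeff P p n \<in> J} (add_monoid P)"
      by (rule P.add.subgroupI)
        (auto simp: J.a_closed a_inv_def[symmetric] J.a_inv_closed intro: exI[of _ "\<zero>\<^bsub>P\<^esub>"])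
  qed (auto simp: J.I_l_closed J.I_r_closed intro!: R.finsum_in_ideal[OF J])
  have L: "ideal ?L A"
    using ring_hom_ring.ideal_vimage[OF rees_algebra_inclusion JP]
    by (rule back_subst[of "\<lambda>X. ideal X A"]) (auto simp: mem_rees_algebra_iff)
  have "ideal (residue ` ?L) Q"
    using residue.R.ring_ideal_imp_quot_ideal[OF ideal_rees_quad_ideal L]
    by (simp add: rees_quotient_eq residue_def[abs_def])
  moreover have "residue (monom P r 0) \<in> residue ` ?L \<longleftrightarrow> r \<in> J" if r: "r \<in> carrier R" for r
  proof
    assume "r \<in> J"
    then have "monom P r 0 \<in> ?L" using const_in_rees_algebra[OF r] r by simp
    then show "residue (monom P r 0) \<in> residue ` ?L" by blast
  next
    assume "residue (monom P r 0) \<in> residue ` ?L"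
    then obtain p where p: "p \<in> ?L" "residue p = residue (monom P r 0)" by force
    have "p \<in> residue (monom P r 0)"
      using N.a_rcos_self[of p] p by (simp add: residue_def)
    then obtain z where z: "z \<in> N" "p = z \<oplus>\<^bsub>P\<^esub> monom P r 0"
      by (auto simp: residue_def a_r_coset_def')
    obtain f where f: "f \<in> carrier P" "z = f \<otimes>\<^bsub>P\<^esub> quad_poly R a b"
      using z(1) by (auto simp: mem_rees_quad_ideal_iff)
    have zP: "z \<in> carrier P" using z(1) by (simp add: mem_rees_quad_ideal_iff mem_rees_algebra_iff)
    \<comment> \<open>All coefficients of \<open>p = z + r\<close> are in \<open>J\<close>, so \<open>z\<close> is constant modulo \<open>J\<close>.\<close>
    have coeffs: "coeff P z n \<oplus> coeff P (monom P r 0) n \<in> J" for n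
      using p(1) z(2) zP r by auto
    have "coeff P z (Suc n) \<in> J" for n
      using coeffs[of "Suc n"] zP r by simp
    then have z0: "coeff P z 0 \<in> J"
      unfolding f(2) by (rule constant_multiple_of_quad_poly[OF J f(1) a_closed b_closed])
    then have "\<ominus> coeff P z 0 \<oplus> (coeff P z 0 \<oplus> r) \<in> J"
      using coeffs[of 0] r J.a_closed J.a_inv_closed by simp
    then show "r \<in> J" using r zP by (simp add: R.r_neg1 R.r_neg2)
  qed
  ultimately show ?thesis by blast
qed

lemma noetherian_if_rees_quotient:
  assumes "noetherian_ring Q"
  shows "noetherian_ring R"
  by (rule noetherian_ring_if_ideals_contracted[OF assms R.ring_axioms residue_constant_hom
        ideal_contracted_from_rees_quotient])

lemma noetherian_rees_quotient_iff: "noetherian_ring Q \<longleftrightarrow> noetherian_ring R"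
  using noetherian_rees_quotient noetherian_if_rees_quotient by blast

end

theorem proposition1p11:
  fixes R :: "('a, 'm) ring_scheme" (structure) and I :: "'a set"
  assumes "cring R" and "ideal I R" and "I \<noteq> carrier R"
  shows "(noetherian_ring R \<longleftrightarrow>
            (\<forall>a\<in>carrier R. \<forall>b\<in>carrier R. noetherian_ring (rees_quotient R I a b)))
       \<and> (noetherian_ring R \<longleftrightarrow>
            (\<exists>a\<in>carrier R. \<exists>b\<in>carrier R. noetherian_ring (rees_quotient R I a b)))"
proof -
  have "noetherian_ring (rees_quotient R I a b) \<longleftrightarrow> noetherian_ring R"
    if "a \<in> carrier R" "b \<in> carrier R" for a b
    by (rule quadratic_rees_quotient.noetherian_rees_quotient_iff)
      (intro quadratic_rees_quotient.intro quadratic_rees_quotient_axioms.intro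
        UP_cring.intro assms that)
  moreover have "\<zero> \<in> carrier R"
    using assms(1) by (simp add: cring.cring_simprules)
  ultimately show ?thesis by blast
qed

end
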